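(* Let $d\ge 2$, $N\ge 1$, let $\mathcal{X}$ be a set, and let $f:\mathcal{X}^{N}\to\mathbb{R}^{d}_{\ge 0}$ be a function for which there are constants $\Delta_2,\Delta_\infty>0$ such that, for all neighboring $x,x'\in\mathcal{X}^N$, $\lVert f(x)-f(x')\rVert_2^2\le\Delta_2^2$ and $\lVert f(x)-f(x')\rVert_\infty\le\Delta_\infty$. Let $\lambda\ge 1$ and $\varepsilon>0$. Let $r>0$ be such that $$\varepsilon=\tfrac12\,\lambda r^{2}\Delta_2^{2}\,\psi'\bigl(1+3(\lambda-1)r\Delta_\infty\bigr),$$ and let $\alpha=1+4(\lambda-1)r\Delta_\infty$. Let $M$ be the randomized mechanism that, on input $x\in\mathcal{X}^N$, outputs a single draw $y\sim\operatorname{Dirichlet}(rf(x)+\alpha)$. Then $M$ is $(\lambda,\varepsilon)$-R\'enyi differentially private, i.e. $D_\lambda(M(x)\,\|\,M(x'))\le\varepsilon$ for all neighboring $x,x'\in\mathcal{X}^N$.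
   Context: Two datasets $x,x'\in\mathcal{X}^N$ are neighboring if they differ on a single entry. $\psi'$ is the trigamma function, $\psi'(t)=\frac{d^2}{dt^2}\log\Gamma(t)=\sum_{k\ge 0}(t+k)^{-2}$ for $t>0$. For $v\in\mathbb{R}^d_{\ge 0}$ and a scalar $\alpha>0$, $\operatorname{Dirichlet}(v+\alpha)$ denotes the Dirichlet distribution on the probability simplex $S^{d-1}=\{p\in\mathbb{R}^d_{\ge 0}:\sum_i p_i=1\}$ with parameter vector $(v_1+\alpha,\ldots,v_d+\alpha)$, whose density is proportional to $\prod_{i=1}^d y_i^{v_i+\alpha-1}$. For probability distributions $P,Q$ (with densities also denoted $P,Q$) and $\lambda>1$, the R\'enyi divergence is $D_\lambda(P\|Q)=\frac{1}{\lambda-1}\log \mathbb{E}_{y\sim P}\bigl[P(y)^{\lambda-1}/Q(y)^{\lambda-1}\bigr]$; for $\lambda=1$, $D_1(P\|Q)$ is the Kullback--Leibler divergence $\mathbb{E}_{y\sim P}[\log (P(y)/Q(y))]$. Here $D_\lambda(M(x)\|M(x'))$ is the divergence between the output distributions of $M$ on inputs $x$ and $x'$. *)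

theory Defs
  imports "HOL-Probability.Probability"
begin

text \<open>
  The set of datasets \<open>X\<^sup>N\<close> is \<open>{..<N} \<rightarrow>\<^sub>E X\<close>, and \<open>\<real>\<^sup>d\<close> is \<open>{..<d} \<rightarrow>\<^sub>E UNIV\<close>.
\<close>

definition neighboring :: "nat \<Rightarrow> 'x set \<Rightarrow> (nat \<Rightarrow> 'x) \<Rightarrow> (nat \<Rightarrow> 'x) \<Rightarrow> bool" where
  "neighboring N X x x' \<longleftrightarrow>
     x \<in> ({..<N} \<rightarrow>\<^sub>E X) \<and> x' \<in> ({..<N} \<rightarrow>\<^sub>E X) \<and> (\<exists>!i. i < N \<and> x i \<noteq> x' i)"

definition prob_simplex :: "nat \<Rightarrow> (nat \<Rightarrow> real) set" where
  "prob_simplex d = {p \<in> {..<d} \<rightarrow>\<^sub>E UNIV. (\<forall>i<d. 0 \<le> p i) \<and> (\<Sum>i<d. p i) = 1}"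

text \<open>
  The reference measure on the simplex is Lebesgue measure in the first \<open>d - 1\<close> coordinates, the
  last coordinate being determined by them. The \<open>(d - 1)\<close>-dimensional surface measure differs from
  it only by a constant factor, which cancels in the normalisation of the Dirichlet density.
\<close>

definition simplex_measure :: "nat \<Rightarrow> (nat \<Rightarrow> real) measure" where
  "simplex_measure d =
     restrict_space
       (distr (\<Pi>\<^sub>M i\<in>{..<d - 1}. lborel) (\<Pi>\<^sub>M i\<in>{..<d}. borel)
          (\<lambda>z. z(d - 1 := 1 - (\<Sum>i<d - 1. z i))))
       (prob_simplex d)"

text \<open>
  Since \<open>0 powr 0 = 0\<close>, a factor with \<open>a i = 1\<close> vanishes where \<open>y i = 0\<close>; this concerns only a null
  set of the reference measure.
\<close>

definition dirichlet_weight :: "nat \<Rightarrow> (nat \<Rightarrow> real) \<Rightarrow> (nat \<Rightarrow> real) \<Rightarrow> real" where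
  "dirichlet_weight d a y = (\<Prod>i<d. y i powr (a i - 1))"

definition dirichlet :: "nat \<Rightarrow> (nat \<Rightarrow> real) \<Rightarrow> (nat \<Rightarrow> real) measure" where
  "dirichlet d a =
     density (simplex_measure d)
       (\<lambda>y. ennreal (dirichlet_weight d a y / (LINT z|simplex_measure d. dirichlet_weight d a z)))"

text \<open>
  For \<open>P\<close> and \<open>Q\<close> with densities \<open>p\<close> and \<open>q\<close>, the Radon--Nikodym derivative \<open>RN_deriv Q P\<close> is the
  ratio \<open>p / q\<close> almost everywhere with respect to \<open>P\<close>, see \<open>AE_RN_deriv_density_ratio\<close> below.
  The divergence is extended-valued: it is infinite if \<open>P\<close> is not absolutely continuous with respect
  to \<open>Q\<close> or if the defining integral diverges, so that the default value \<open>0\<close> of the Bochner integral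
  of a non-integrable function never enters. Note that the library's \<open>KL_divergence b Q P\<close> is the
  divergence of \<open>P\<close> from \<open>Q\<close>, i.e. the integral of \<open>log b (p / q)\<close> with respect to \<open>P\<close>. The
  definition is meant for \<open>l \<ge> 1\<close> and probability measures \<open>P\<close>, \<open>Q\<close> on the same measurable space.
\<close>

definition renyi_divergence :: "real \<Rightarrow> 'a measure \<Rightarrow> 'a measure \<Rightarrow> ereal" where
  "renyi_divergence l P Q =
     (if \<not> absolutely_continuous Q P then \<infinity>
      else if l = 1 then
        (if integrable P (entropy_density (exp 1) Q P)
         then ereal (KL_divergence (exp 1) Q P) else \<infinity>)
      else
        (let E = (\<integral>\<^sup>+ y. ennreal (enn2real (RN_deriv Q P y) powr (l - 1)) \<partial>P)
         in if E = \<infinity> then \<infinity> else ereal (1 / (l - 1) * ln (enn2real E))))"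

lemma AE_RN_deriv_density_ratio:
  fixes p q :: "'a \<Rightarrow> real"
  assumes [measurable]: "p \<in> borel_measurable M" "q \<in> borel_measurable M"
    and nonneg: "\<And>y. 0 \<le> p y" "\<And>y. 0 \<le> q y"
    and P: "P = density M p" and Q: "Q = density M q" and "prob_space Q"
    and ac: "AE y in M. q y = 0 \<longrightarrow> p y = 0"
  shows "AE y in P. enn2real (RN_deriv Q P y) = p y / q y"
proof -
  interpret Q: prob_space Q by fact
  have "density Q (\<lambda>y. ennreal (p y / q y)) = density M (\<lambda>y. ennreal (q y) * ennreal (p y / q y))"
    unfolding Q by (subst density_density_eq) auto
  also have "\<dots> = P"
    unfolding P using ac
    by (intro density_cong) (auto simp: ennreal_mult[symmetric] nonneg)
  finally have "AE y in Q. ennreal (p y / q y) = RN_deriv Q P y"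
    by (intro Q.RN_deriv_unique) (auto simp: Q)
  then have "AE y in M. 0 < q y \<longrightarrow> ennreal (p y / q y) = RN_deriv Q P y"
    unfolding Q by (subst (asm) AE_density) auto
  with ac have "AE y in M. 0 < p y \<longrightarrow> enn2real (RN_deriv Q P y) = p y / q y"
  proof eventually_elim
    case (elim y)
    then show ?case
      using nonneg[of y] by (metis enn2real_ennreal less_eq_real_def less_irrefl divide_nonneg_nonneg)
  qed
  then show ?thesis
    unfolding P by (subst AE_density) auto
qed

text \<open>A randomized mechanism is given by its output distribution on each input.\<close>

definition renyi_dp ::
  "('db \<Rightarrow> 'db \<Rightarrow> bool) \<Rightarrow> real \<Rightarrow> real \<Rightarrow> ('db \<Rightarrow> 'y measure) \<Rightarrow> bool" where
  "renyi_dp nbr l eps M \<longleftrightarrow>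
     (\<forall>x x'. nbr x x' \<longrightarrow> renyi_divergence l (M x) (M x') \<le> ereal eps)"

end

theory Submission
  imports Defs
begin

text \<open>
  The Dirichlet distributions form an exponential family, so with \<open>u\<close>, \<open>v\<close> the two parameter
  vectors, \<open>w = u - v\<close> and \<open>s = \<lambda> - 1 > 0\<close>, the divergence is
  \<open>(A (u + s w) - (1 + s) A u + s A v) / s\<close> for \<open>A a = (\<Sum>i. ln \<Gamma> (a\<^sub>i)) - ln \<Gamma> (\<Sum>i. a\<^sub>i)\<close>.
  Since \<open>u\<close> is a convex combination of \<open>v\<close> and \<open>u + s w\<close>, convexity of \<open>ln \<Gamma>\<close> shows that the second
  term of \<open>A\<close> contributes a nonpositive amount, and convexity of \<open>\<psi>' m x\<^sup>2 / 2 - ln \<Gamma> x\<close> on \<open>x \<ge> m\<close>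
  bounds the contribution of each coordinate by \<open>(1 + s) \<psi>' m w\<^sub>i\<^sup>2 / 2\<close>. The choice of \<open>\<alpha>\<close> makes all
  parameters involved at least \<open>m = 1 + 3 (\<lambda> - 1) r \<Delta>\<^sub>\<infinity>\<close>. For \<open>\<lambda> = 1\<close>, the Kullback--Leibler divergence is
  bounded by the divergence of order \<open>1 + s\<close> for every small \<open>s > 0\<close>, and \<open>s\<close> tends to \<open>0\<close>.
\<close>

subsection \<open>The Dirichlet integral\<close>

text \<open>The cut-off at \<open>0\<close> makes the simplex constraint implicit, so that Dirichlet integrals become
  iterated convolutions over the whole line.\<close>

definition pos_powr :: "real \<Rightarrow> real \<Rightarrow> real" where
  "pos_powr x a = (if 0 < x then x powr a else 0)"

lemma pos_powr_nonneg [simp]: "0 \<le> pos_powr x a"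
  by (simp add: pos_powr_def)

lemma borel_measurable_pos_powr [measurable]:
  assumes [measurable]: "f \<in> borel_measurable M"
  shows "(\<lambda>x. pos_powr (f x) a) \<in> borel_measurable M"
  unfolding pos_powr_def by measurable

text \<open>For \<open>T > 0\<close> the substitution \<open>x = T * t\<close> turns the integral
  into the Beta integral over \<open>{0..1}\<close> and pulls out a power of \<open>T\<close>. For
  \<open>T \<le> 0\<close> the numbers \<open>x\<close> and \<open>T - x\<close> are never both
  positive, so the integrand is zero.\<close>

lemma nn_integral_pos_powr_convolution:
  assumes a: "a > 0" and b: "b > 0"
  shows "(\<integral>\<^sup>+x. ennreal (pos_powr x (a - 1) * pos_powr (T - x) (b - 1)) \<partial>lborel) =
    ennreal (Beta a b * pos_powr T (a + b - 1))"
proof (cases "0 < T")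
  case False
  then have zero: "pos_powr x (a - 1) * pos_powr (T - x) (b - 1) = 0" for x
    by (auto simp: pos_powr_def)
  from False show ?thesis
    by (simp only: zero) (simp add: pos_powr_def)
next
  case True
  define g where "g x = pos_powr x (a - 1) * pos_powr (T - x) (b - 1)" for x
  have "(\<integral>\<^sup>+x. ennreal (g x) \<partial>lborel) = ennreal T * (\<integral>\<^sup>+t. ennreal (g (T * t)) \<partial>lborel)"
    using True by (subst nn_integral_real_affine[of _ T 0]) (auto simp: g_def)
  also have "(\<integral>\<^sup>+t. ennreal (g (T * t)) \<partial>lborel) =
    (\<integral>\<^sup>+t. ennreal (T powr (a + b - 2)) *
        (ennreal (t powr (a - 1) * (1 - t) powr (b - 1)) * indicator {0..1} t) \<partial>lborel)"
  proof (intro nn_integral_cong)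
    fix t :: real
    have "g (T * t) = T powr (a + b - 2) * (t powr (a - 1) * (1 - t) powr (b - 1))"
      if "0 < t" "t < 1"
    proof -
      have "T - T * t = T * (1 - t)"
        by (simp add: algebra_simps)
      moreover have "T powr (a + b - 2) = T powr (a - 1) * T powr (b - 1)"
        by (simp flip: powr_add)
      ultimately show ?thesis
        using that True by (simp add: g_def pos_powr_def powr_mult)
    qed
    moreover have "g (T * t) = 0" if "t \<le> 0 \<or> 1 \<le> t"
      using that True by (auto simp: g_def pos_powr_def zero_less_mult_iff)
    \<comment> \<open>At the endpoints \<open>0 powr c = 0\<close>, whatever the sign of
      \<open>c\<close>, so the Beta integrand agrees there with the cut-off one.\<close>
    moreover have "t powr (a - 1) * (1 - t) powr (b - 1) = 0" if "t = 0 \<or> t = 1"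
      using that by auto
    ultimately show "ennreal (g (T * t)) = ennreal (T powr (a + b - 2)) *
        (ennreal (t powr (a - 1) * (1 - t) powr (b - 1)) * indicator {0..1} t)"
      by (cases "0 < t \<and> t < 1") (auto simp: indicator_def ennreal_mult' not_less)
  qed
  also have "\<dots> = ennreal (T powr (a + b - 2)) * ennreal (Beta a b)"
    using has_integral_Beta_real[OF a b]
    by (subst nn_integral_cmult)
      (auto intro!: arg_cong[where f="(*) (ennreal _)"] nn_integral_has_integral_lebesgue')
  also have "ennreal T * (ennreal (T powr (a + b - 2)) * ennreal (Beta a b)) =
    ennreal (Beta a b * (T powr 1 * T powr (a + b - 2)))"
    using True a b by (subst ennreal_mult'[symmetric], simp)+ (simp add: ac_simps)
  also have "T powr 1 * T powr (a + b - 2) = pos_powr T (a + b - 1)"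
    using True by (simp only: pos_powr_def powr_add[symmetric] if_True) (simp add: algebra_simps)
  finally show ?thesis
    by (simp add: g_def)
qed

text \<open>Induction on \<open>n\<close> for all totals \<open>T\<close> at once: for fixed
  \<open>z n = x\<close>, the inner integral over the other coordinates is the same problem with
  total \<open>T - x\<close>. The outer integral is then a convolution, and its factor
  \<open>Beta (a n) B\<close> cancels the \<open>Gamma B\<close> left by the induction
  hypothesis.\<close>

lemma nn_integral_dirichlet_lebesgue:
  fixes n :: nat
  assumes "\<And>i. i < n \<Longrightarrow> 0 < a i" "0 < b"
  shows "(\<integral>\<^sup>+z. ennreal ((\<Prod>i<n. pos_powr (z i) (a i - 1)) * pos_powr (T - (\<Sum>i<n. z i)) (b - 1))
      \<partial>(\<Pi>\<^sub>M i\<in>{..<n}. lborel)) =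
    ennreal ((\<Prod>i<n. Gamma (a i)) * Gamma b / Gamma ((\<Sum>i<n. a i) + b) *
      pos_powr T ((\<Sum>i<n. a i) + b - 1))"
  using assms(1)
proof (induction n arbitrary: T)
  case 0
  interpret product_sigma_finite "\<lambda>_. lborel :: real measure" ..
  from assms(2) have "Gamma b \<noteq> 0"
    by (metis Gamma_real_pos less_irrefl)
  then show ?case
    by (simp add: PiM_empty nn_integral_count_space_finite)
next
  case (Suc n)
  interpret product_sigma_finite "\<lambda>_. lborel :: real measure" ..
  define B where "B = (\<Sum>i<n. a i) + b"
  define C where "C = (\<Prod>i<n. Gamma (a i)) * Gamma b / Gamma B"
  have B: "0 < B"
    unfolding B_def using Suc.prems assms(2) by (intro add_nonneg_pos sum_nonneg) (auto simp: less_imp_le)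
  have C: "0 \<le> C"
    unfolding C_def using Suc.prems assms(2) B
    by (intro divide_nonneg_nonneg mult_nonneg_nonneg prod_nonneg) (auto intro!: less_imp_le[OF Gamma_real_pos])
  have an: "0 < a n"
    using Suc.prems by simp
  let ?F = "\<lambda>n T z. (\<Prod>i<n. pos_powr (z i) (a i - 1)) * pos_powr (T - (\<Sum>i<n. z i)) (b - 1)"
  have "(\<integral>\<^sup>+z. ennreal (?F (Suc n) T z) \<partial>(\<Pi>\<^sub>M i\<in>{..<Suc n}. lborel)) =
    (\<integral>\<^sup>+x. \<integral>\<^sup>+z. ennreal (?F (Suc n) T (z(n := x))) \<partial>(\<Pi>\<^sub>M i\<in>{..<n}. lborel) \<partial>lborel)"
    unfolding lessThan_Suc
    by (subst product_nn_integral_insert_rev) (auto simp: lessThan_Suc[symmetric] simp del: prod.lessThan_Suc sum.lessThan_Suc)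
  also have "\<dots> = (\<integral>\<^sup>+x. \<integral>\<^sup>+z. ennreal (pos_powr x (a n - 1)) * ennreal (?F n (T - x) z)
      \<partial>(\<Pi>\<^sub>M i\<in>{..<n}. lborel) \<partial>lborel)"
    by (intro nn_integral_cong) (simp add: ennreal_mult'[symmetric] algebra_simps)
  also have "\<dots> = (\<integral>\<^sup>+x. ennreal (pos_powr x (a n - 1)) * ennreal (C * pos_powr (T - x) (B - 1)) \<partial>lborel)"
    using Suc by (subst nn_integral_cmult) (simp_all add: B_def C_def)
  also have "\<dots> = (\<integral>\<^sup>+x. ennreal C * ennreal (pos_powr x (a n - 1) * pos_powr (T - x) (B - 1)) \<partial>lborel)"
    using C by (intro nn_integral_cong) (simp add: ennreal_mult'[symmetric] mult_ac)
  also have "\<dots> = ennreal C * ennreal (Beta (a n) B * pos_powr T (a n + B - 1))"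
    using nn_integral_pos_powr_convolution[OF an B] by (subst nn_integral_cmult) auto
  also have "\<dots> = ennreal (C * Beta (a n) B * pos_powr T (a n + B - 1))"
    using C by (simp add: ennreal_mult'[symmetric] mult.assoc)
  also have "C * Beta (a n) B = (\<Prod>i<Suc n. Gamma (a i)) * Gamma b / Gamma (a n + B)"
    using Gamma_real_pos[OF B] by (simp add: C_def Beta_def mult_ac)
  finally show ?case
    by (simp add: B_def add_ac)
qed

section \<open>Normalisation of the Dirichlet weight on the simplex\<close>

definition multi_Beta :: "nat \<Rightarrow> (nat \<Rightarrow> real) \<Rightarrow> real" where
  "multi_Beta d a = (\<Prod>i<d. Gamma (a i)) / Gamma (\<Sum>i<d. a i)"

lemma multi_Beta_pos:
  assumes "1 \<le> d" "\<And>i. i < d \<Longrightarrow> 0 < a i"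
  shows "0 < multi_Beta d a"
  unfolding multi_Beta_def using assms
  by (intro divide_pos_pos prod_pos Gamma_real_pos sum_pos) (auto simp: lessThan_empty_iff)

lemma sets_prob_simplex: "prob_simplex d \<in> sets (\<Pi>\<^sub>M i\<in>{..<d}. borel)"
proof -
  have "prob_simplex d = {p \<in> space (\<Pi>\<^sub>M i\<in>{..<d}. borel). (\<forall>i\<in>{..<d}. 0 \<le> p i) \<and> (\<Sum>i<d. p i) = 1}"
    by (auto simp: prob_simplex_def space_PiM)
  also have "\<dots> \<in> sets (\<Pi>\<^sub>M i\<in>{..<d}. borel)"
    by measurable
  finally show ?thesis .
qed

lemma borel_measurable_dirichlet_weight [measurable]:
  "dirichlet_weight d a \<in> borel_measurable (simplex_measure d)"
proof -
  have "dirichlet_weight d a \<in> borel_measurable (\<Pi>\<^sub>M i\<in>{..<d}. borel)"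
    unfolding dirichlet_weight_def by measurable
  then show ?thesis
    unfolding simplex_measure_def by (intro measurable_restrict_space1) simp
qed

lemma dirichlet_weight_nonneg [simp]: "0 \<le> dirichlet_weight d a y"
  unfolding dirichlet_weight_def by (intro prod_nonneg) simp

text \<open>Pulled back along the map \<open>?e\<close> that supplies the last coordinate, the
  weight restricted to the simplex becomes the cut-off product with total \<open>1\<close>.\<close>

lemma nn_integral_dirichlet_weight:
  assumes "1 \<le> d" "\<And>i. i < d \<Longrightarrow> 0 < a i"
  shows "(\<integral>\<^sup>+y. ennreal (dirichlet_weight d a y) \<partial>simplex_measure d) = ennreal (multi_Beta d a)"
proof -
  obtain n where d: "d = Suc n"
    using assms(1) by (cases d) auto
  let ?L = "\<Pi>\<^sub>M i\<in>{..<n}. (lborel :: real measure)"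
  let ?e = "\<lambda>z::nat \<Rightarrow> real. z(n := 1 - (\<Sum>i<n. z i))"
  have e [measurable]: "?e \<in> measurable ?L (\<Pi>\<^sub>M i\<in>{..<Suc n}. borel)"
    unfolding lessThan_Suc by (intro measurable_fun_upd[where J="{..<n}"]) auto
  have [measurable]: "dirichlet_weight (Suc n) a \<in> borel_measurable (\<Pi>\<^sub>M i\<in>{..<Suc n}. borel)"
    unfolding dirichlet_weight_def by measurable
  note sets_prob_simplex[measurable]
  have "(\<integral>\<^sup>+y. ennreal (dirichlet_weight d a y) \<partial>simplex_measure d) =
    (\<integral>\<^sup>+z. ennreal (dirichlet_weight (Suc n) a (?e z)) * indicator (prob_simplex (Suc n)) (?e z) \<partial>?L)"
    using sets_prob_simplex[of "Suc n"]
    by (simp add: d simplex_measure_def nn_integral_restrict_space nn_integral_distr)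
  also have "\<dots> = (\<integral>\<^sup>+z. ennreal ((\<Prod>i<n. pos_powr (z i) (a i - 1)) *
      pos_powr (1 - (\<Sum>i<n. z i)) (a n - 1)) \<partial>?L)"
  proof (intro nn_integral_cong)
    fix z assume z: "z \<in> space ?L"
    then have ez: "?e z \<in> {..<Suc n} \<rightarrow>\<^sub>E UNIV"
      by (auto simp: space_PiM PiE_def extensional_def)
    have w: "dirichlet_weight (Suc n) a (?e z) = (\<Prod>i<n. z i powr (a i - 1)) * (1 - (\<Sum>i<n. z i)) powr (a n - 1)"
      by (simp add: dirichlet_weight_def)
    show "ennreal (dirichlet_weight (Suc n) a (?e z)) * indicator (prob_simplex (Suc n)) (?e z) =
      ennreal ((\<Prod>i<n. pos_powr (z i) (a i - 1)) * pos_powr (1 - (\<Sum>i<n. z i)) (a n - 1))"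
    proof (cases "?e z \<in> prob_simplex (Suc n)")
      case True
      then have "\<And>i. i < n \<Longrightarrow> 0 \<le> z i" "0 \<le> 1 - (\<Sum>i<n. z i)"
        by (auto simp: prob_simplex_def less_Suc_eq all_conj_distrib split: if_splits)
      \<comment> \<open>On the boundary of the simplex the two sides agree because
        \<open>0 powr c = 0\<close>.\<close>
      moreover have "0 \<le> x \<Longrightarrow> x powr c = pos_powr x c" for x c :: real
        by (auto simp: pos_powr_def)
      ultimately show ?thesis
        using True by (simp add: w)
    next
      case False
      \<comment> \<open>The coordinates of \<open>?e z\<close> sum to \<open>1\<close> by
        construction, so the simplex can only be left through a negative coordinate, where the
        cut-off gives zero.\<close>
      then have "(\<exists>i<n. z i < 0) \<or> 1 - (\<Sum>i<n. z i) < 0"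
        using ez by (auto simp: prob_simplex_def less_Suc_eq not_less split: if_splits)
      then have zero: "(\<Prod>i<n. pos_powr (z i) (a i - 1)) * pos_powr (1 - (\<Sum>i<n. z i)) (a n - 1) = 0"
        by (force simp: pos_powr_def)
      show ?thesis
        using False by (simp only: zero) simp
    qed
  qed
  also have "\<dots> = ennreal (multi_Beta d a)"
    using assms(2) by (subst nn_integral_dirichlet_lebesgue) (simp_all add: d multi_Beta_def pos_powr_def)
  finally show ?thesis .
qed

lemma integral_dirichlet_weight:
  assumes "1 \<le> d" "\<And>i. i < d \<Longrightarrow> 0 < a i"
  shows "(LINT y|simplex_measure d. dirichlet_weight d a y) = multi_Beta d a"
  using nn_integral_dirichlet_weight[OF assms] multi_Beta_pos[OF assms]
  by (subst integral_eq_nn_integral) auto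


subsection \<open>Convexity bounds for the log-partition function\<close>

text \<open>The point \<open>u\<close> divides the segment from \<open>v\<close> to
  \<open>u + s * (u - v)\<close> with weight \<open>t = 1 / (1 + s)\<close> on the far end; the
  claim is convexity at \<open>u\<close>, multiplied by \<open>1 + s\<close>.\<close>

lemma convex_on_extrapolate:
  fixes f :: "real \<Rightarrow> real"
  assumes "convex_on A f" "v \<in> A" "u + s * (u - v) \<in> A" "0 < s"
  shows "(1 + s) * f u \<le> f (u + s * (u - v)) + s * f v"
proof -
  define t where "t = 1 / (1 + s)"
  have t: "0 \<le> t" "t \<le> 1" "(1 + s) * t = 1" "(1 + s) * (1 - t) = s"
    using assms(4) by (auto simp: t_def field_simps)
  have "(1 - t) * v + t * (u + s * (u - v)) = u"
    using assms(4) unfolding t_def by (simp add: divide_simps) (simp add: algebra_simps)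
  with convex_onD[OF assms(1) t(1,2) assms(2,3)]
  have "f u \<le> (1 - t) * f v + t * f (u + s * (u - v))"
    by simp
  then have "(1 + s) * f u \<le> (1 + s) * ((1 - t) * f v + t * f (u + s * (u - v)))"
    using assms(4) by (intro mult_left_mono) auto
  also have "\<dots> = ((1 + s) * (1 - t)) * f v + ((1 + s) * t) * f (u + s * (u - v))"
    by (simp only: distrib_left mult.assoc)
  finally show ?thesis
    by (simp add: t)
qed

lemma Polygamma_real_antimono:
  assumes "0 < x" "x \<le> (y::real)" "odd n"
  shows "Polygamma n y \<le> Polygamma n x"
  using Polygamma_real_strict_antimono[OF assms(1) _ assms(3), of y] assms(2)
  by (cases "x = y") auto

text \<open>The second derivative is \<open>Polygamma 1 m - Polygamma 1 x\<close>, and the trigamma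
  function is decreasing. An upper bound on the curvature of \<open>ln_Gamma\<close> thus becomes a
  convexity statement, to which \<open>convex_on_extrapolate\<close> applies.\<close>

lemma convex_on_quadratic_minus_ln_Gamma:
  fixes m :: real
  assumes "0 < m"
  shows "convex_on {m..} (\<lambda>x. Polygamma 1 m / 2 * x\<^sup>2 - ln_Gamma x)"
proof (rule f''_ge0_imp_convex)
  fix x assume x: "x \<in> {m..}"
  then have "0 < x" "x \<notin> \<int>\<^sub>\<le>\<^sub>0"
    using assms by (auto elim!: nonpos_Ints_cases)
  then show "((\<lambda>x. Polygamma 1 m / 2 * x\<^sup>2 - ln_Gamma x) has_real_derivative
      Polygamma 1 m * x - Digamma x) (at x)"
    and "((\<lambda>x. Polygamma 1 m * x - Digamma x) has_real_derivative Polygamma 1 m - Polygamma 1 x) (at x)"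
    by (auto intro!: derivative_eq_intros)
  show "0 \<le> Polygamma 1 m - Polygamma 1 x"
    using Polygamma_real_antimono[of m x 1] assms x by simp
qed auto

lemma ln_Gamma_extrapolate_le:
  fixes m s u v :: real
  assumes "0 < m" "m \<le> v" "m \<le> u + s * (u - v)" "m \<le> u" "0 < s"
  shows "ln (Gamma (u + s * (u - v))) + s * ln (Gamma v) - (1 + s) * ln (Gamma u)
    \<le> s * ((1 + s) / 2 * Polygamma 1 m * (u - v)\<^sup>2)"
proof -
  define K where "K = Polygamma 1 m / 2"
  have "(1 + s) * (K * u\<^sup>2 - ln_Gamma u) \<le>
      (K * (u + s * (u - v))\<^sup>2 - ln_Gamma (u + s * (u - v))) + s * (K * v\<^sup>2 - ln_Gamma v)"
    unfolding K_def using assms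
    by (intro convex_on_extrapolate[OF convex_on_quadratic_minus_ln_Gamma]) auto
  \<comment> \<open>For the quadratic part the extrapolation gap is computed exactly: the terms
    linear in \<open>u - v\<close> cancel.\<close>
  moreover have "K * (u + s * (u - v))\<^sup>2 + s * (K * v\<^sup>2) - (1 + s) * (K * u\<^sup>2) = s * ((1 + s) * K * (u - v)\<^sup>2)"
    by (simp add: algebra_simps power2_eq_square)
  ultimately have "ln_Gamma (u + s * (u - v)) + s * ln_Gamma v - (1 + s) * ln_Gamma u \<le> s * ((1 + s) * K * (u - v)\<^sup>2)"
    by (simp add: algebra_simps)
  then show ?thesis
    using assms by (simp add: K_def ln_Gamma_real_pos)
qed

lemma ln_multi_Beta:
  assumes "1 \<le> d" "\<And>i. i < d \<Longrightarrow> 0 < a i"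
  shows "ln (multi_Beta d a) = (\<Sum>i<d. ln (Gamma (a i))) - ln (Gamma (\<Sum>i<d. a i))"
proof -
  have "0 < (\<Sum>i<d. a i)"
    using assms by (intro sum_pos) (auto simp: lessThan_empty_iff)
  then have "0 < Gamma (\<Sum>i<d. a i)"
    by (rule Gamma_real_pos)
  moreover have "0 < (\<Prod>i<d. Gamma (a i))"
    using assms(2) by (intro prod_pos) auto
  moreover have "ln (\<Prod>i<d. Gamma (a i)) = (\<Sum>i<d. ln (Gamma (a i)))"
    using assms(2) by (intro ln_prod) (auto intro!: less_imp_neq[OF Gamma_real_pos, symmetric])
  ultimately show ?thesis
    by (metis ln_div less_irrefl multi_Beta_def)
qed

lemma ln_multi_Beta_extrapolate_le:
  fixes m s :: real
  assumes "1 \<le> d" "0 < m" "0 < s"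
    and "\<And>i. i < d \<Longrightarrow> m \<le> u i" "\<And>i. i < d \<Longrightarrow> m \<le> v i" "\<And>i. i < d \<Longrightarrow> m \<le> u i + s * (u i - v i)"
  shows "ln (multi_Beta d (\<lambda>i. u i + s * (u i - v i))) + s * ln (multi_Beta d v) - (1 + s) * ln (multi_Beta d u)
    \<le> s * ((1 + s) / 2 * Polygamma 1 m * (\<Sum>i<d. (u i - v i)\<^sup>2))"
proof -
  let ?w = "\<lambda>i. u i + s * (u i - v i)"
  have pos: "0 < u i" "0 < v i" "0 < ?w i" if "i < d" for i
    using assms(4-6)[OF that] assms(2) by linarith+
  have sum_pos': "0 < (\<Sum>i<d. a i)" if "\<And>i. i < d \<Longrightarrow> 0 < a i" for a :: "nat \<Rightarrow> real"
    using assms(1) that by (intro sum_pos) (auto simp: lessThan_empty_iff)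
  have sum_w: "(\<Sum>i<d. ?w i) = (\<Sum>i<d. u i) + s * ((\<Sum>i<d. u i) - (\<Sum>i<d. v i))"
    by (simp add: sum.distrib sum_subtractf flip: sum_distrib_left)
  \<comment> \<open>The parameter sums are in the same extrapolation position as the coordinates.
    Since \<open>ln (Gamma (\<Sum>i<d. a i))\<close> enters \<open>ln (multi_Beta d a)\<close> with
    a minus sign, plain log-convexity suffices here.\<close>
  have "(1 + s) * ln (Gamma (\<Sum>i<d. u i)) \<le> ln (Gamma (\<Sum>i<d. ?w i)) + s * ln (Gamma (\<Sum>i<d. v i))"
    using convex_on_extrapolate[OF log_convex_Gamma_real, of "\<Sum>i<d. v i" "\<Sum>i<d. u i" s]
      sum_pos'[of v] sum_pos'[of ?w] pos assms(3) by (simp add: sum_w)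
  moreover have "(\<Sum>i<d. ln (Gamma (?w i)) + s * ln (Gamma (v i)) - (1 + s) * ln (Gamma (u i)))
      \<le> (\<Sum>i<d. s * ((1 + s) / 2 * Polygamma 1 m * (u i - v i)\<^sup>2))"
    using assms by (intro sum_mono ln_Gamma_extrapolate_le) auto
  then have "(\<Sum>i<d. ln (Gamma (?w i))) + s * (\<Sum>i<d. ln (Gamma (v i))) - (1 + s) * (\<Sum>i<d. ln (Gamma (u i)))
      \<le> s * ((1 + s) / 2 * Polygamma 1 m * (\<Sum>i<d. (u i - v i)\<^sup>2))"
    by (simp only: sum.distrib sum_subtractf sum_distrib_left[symmetric])
  ultimately have "((\<Sum>i<d. ln (Gamma (?w i))) - ln (Gamma (\<Sum>i<d. ?w i)))
      + s * ((\<Sum>i<d. ln (Gamma (v i))) - ln (Gamma (\<Sum>i<d. v i)))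
      - (1 + s) * ((\<Sum>i<d. ln (Gamma (u i))) - ln (Gamma (\<Sum>i<d. u i)))
      \<le> s * ((1 + s) / 2 * Polygamma 1 m * (\<Sum>i<d. (u i - v i)\<^sup>2))"
    unfolding right_diff_distrib by linarith
  then show ?thesis
    using assms(1) pos by (simp only: ln_multi_Beta)
qed

subsection \<open>Renyi divergence of two Dirichlet distributions\<close>

definition dirichlet_density :: "nat \<Rightarrow> (nat \<Rightarrow> real) \<Rightarrow> (nat \<Rightarrow> real) \<Rightarrow> real" where
  "dirichlet_density d a y = dirichlet_weight d a y / multi_Beta d a"

lemma borel_measurable_dirichlet_density [measurable]:
  "dirichlet_density d a \<in> borel_measurable (simplex_measure d)"
  unfolding dirichlet_density_def by measurable

lemma dirichlet_eq_density:
  assumes "1 \<le> d" "\<And>i. i < d \<Longrightarrow> 0 < a i"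
  shows "dirichlet d a = density (simplex_measure d) (\<lambda>y. ennreal (dirichlet_density d a y))"
  using assms by (simp add: dirichlet_def dirichlet_density_def integral_dirichlet_weight)

lemma nn_integral_dirichlet_density:
  assumes "1 \<le> d" "\<And>i. i < d \<Longrightarrow> 0 < a i"
  shows "(\<integral>\<^sup>+y. ennreal (dirichlet_density d a y) \<partial>simplex_measure d) = 1"
proof -
  have B: "0 < multi_Beta d a"
    using assms by (rule multi_Beta_pos)
  then have "(\<integral>\<^sup>+y. ennreal (dirichlet_density d a y) \<partial>simplex_measure d) =
    (\<integral>\<^sup>+y. ennreal (1 / multi_Beta d a) * ennreal (dirichlet_weight d a y) \<partial>simplex_measure d)"
    by (intro nn_integral_cong) (simp add: dirichlet_density_def ennreal_mult'[symmetric])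
  also have "\<dots> = ennreal (1 / multi_Beta d a) * ennreal (multi_Beta d a)"
    using assms by (subst nn_integral_cmult) (simp_all add: nn_integral_dirichlet_weight)
  also have "\<dots> = 1"
    using B by (simp add: ennreal_mult'[symmetric])
  finally show ?thesis .
qed

lemma prob_space_dirichlet:
  assumes "1 \<le> d" "\<And>i. i < d \<Longrightarrow> 0 < a i"
  shows "prob_space (dirichlet d a)"
  using assms
  by (intro prob_spaceI)
    (simp add: dirichlet_eq_density emeasure_density nn_integral_dirichlet_density
      cong: nn_integral_cong_simp)

section \<open>The density ratio and its moments\<close>

locale dirichlet_pair =
  fixes d :: nat and u v :: "nat \<Rightarrow> real"
  assumes d: "1 \<le> d"
    and u_pos: "\<And>i. i < d \<Longrightarrow> 0 < u i" and v_pos: "\<And>i. i < d \<Longrightarrow> 0 < v i"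
begin

abbreviation "P \<equiv> dirichlet d u"
abbreviation "Q \<equiv> dirichlet d v"

text \<open>Where some coordinate is zero both densities vanish and the quotient is
  \<open>0 / 0 = 0\<close>; by \<open>AE_ratio_pos\<close> this happens only on a null set of
  \<open>P\<close>.\<close>

definition ratio :: "(nat \<Rightarrow> real) \<Rightarrow> real" where
  "ratio y = dirichlet_density d u y / dirichlet_density d v y"

text \<open>Logarithm of the moment of \<open>ratio\<close> of order \<open>s\<close> under
  \<open>P\<close>, in closed form; see \<open>nn_integral_ratio_powr\<close>.\<close>

definition log_moment :: "real \<Rightarrow> real" where
  "log_moment s = ln (multi_Beta d (\<lambda>i. u i + s * (u i - v i))) + s * ln (multi_Beta d v)
     - (1 + s) * ln (multi_Beta d u)"

sublocale P: prob_space P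
  using d u_pos by (rule prob_space_dirichlet)

sublocale Q: prob_space Q
  using d v_pos by (rule prob_space_dirichlet)

lemma P_eq: "P = density (simplex_measure d) (\<lambda>y. ennreal (dirichlet_density d u y))"
  using d u_pos by (rule dirichlet_eq_density)

lemma Q_eq: "Q = density (simplex_measure d) (\<lambda>y. ennreal (dirichlet_density d v y))"
  using d v_pos by (rule dirichlet_eq_density)

lemma sets_P [measurable_cong]: "sets P = sets (simplex_measure d)"
  by (simp add: P_eq)

lemma sets_Q [measurable_cong]: "sets Q = sets (simplex_measure d)"
  by (simp add: Q_eq)

lemma borel_measurable_ratio [measurable]: "ratio \<in> borel_measurable (simplex_measure d)"
  unfolding ratio_def by measurable

lemma multi_Beta_uv_pos: "0 < multi_Beta d u" "0 < multi_Beta d v"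
  using d u_pos v_pos by (auto intro: multi_Beta_pos)

lemma dirichlet_density_nonneg: "0 \<le> dirichlet_density d u y" "0 \<le> dirichlet_density d v y"
  using multi_Beta_uv_pos by (simp_all add: dirichlet_density_def)

lemma ratio_nonneg: "0 \<le> ratio y"
  using dirichlet_density_nonneg by (simp add: ratio_def)

text \<open>As \<open>0 powr c = 0\<close> for every exponent, the zero set does not depend on the
  parameters. This gives absolute continuity and the positivity of \<open>ratio\<close> almost
  everywhere.\<close>

lemma dirichlet_density_eq_0_iff:
  "dirichlet_density d u y = 0 \<longleftrightarrow> (\<exists>i<d. y i = 0)" "dirichlet_density d v y = 0 \<longleftrightarrow> (\<exists>i<d. y i = 0)"
  using multi_Beta_uv_pos
  by (auto simp: dirichlet_density_def dirichlet_weight_def)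

lemma AE_RN_deriv: "AE y in P. enn2real (RN_deriv Q P y) = ratio y"
  unfolding ratio_def
  by (rule AE_RN_deriv_density_ratio[OF _ _ _ _ P_eq Q_eq Q.prob_space_axioms])
    (auto simp: dirichlet_density_nonneg dirichlet_density_eq_0_iff)

lemma absolutely_continuous: "absolutely_continuous Q P"
  unfolding absolutely_continuous_def P_eq Q_eq
  by (auto simp: null_sets_density_iff dirichlet_density_nonneg less_le dirichlet_density_eq_0_iff
      elim!: AE_mp)

lemma AE_ratio_pos: "AE y in P. 0 < ratio y"
  unfolding P_eq using dirichlet_density_nonneg
  by (subst AE_density) (auto simp: ratio_def less_le dirichlet_density_eq_0_iff)

text \<open>Tilting the first density by \<open>ratio y powr s\<close> gives an unnormalised
  Dirichlet weight with parameter \<open>?w\<close>, whose mass is known; \<open>C\<close> collects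
  the normalising constants. The order \<open>s\<close> may be negative.\<close>

lemma nn_integral_ratio_powr:
  assumes "\<And>i. i < d \<Longrightarrow> 0 < u i + s * (u i - v i)"
  shows "(\<integral>\<^sup>+y. ennreal (ratio y powr s) \<partial>P) = ennreal (exp (log_moment s))"
proof -
  let ?w = "\<lambda>i. u i + s * (u i - v i)"
  let ?B = "multi_Beta d"
  have B: "0 < ?B u" "0 < ?B v" "0 < ?B ?w"
    using multi_Beta_uv_pos d assms by (auto intro: multi_Beta_pos)
  define C where "C = ?B v powr s / ?B u powr (1 + s)"
  have C: "0 \<le> C"
    by (simp add: C_def)
  have eq: "dirichlet_density d u y * ratio y powr s = C * dirichlet_weight d ?w y" for y
  proof -
    \<comment> \<open>In each coordinate the exponents add up to
      \<open>(u i - 1) + s * (u i - v i) = ?w i - 1\<close>; if some \<open>y i\<close> is zero,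
      both sides are zero.\<close>
    have weight: "dirichlet_weight d u y * (dirichlet_weight d u y / dirichlet_weight d v y) powr s =
        dirichlet_weight d ?w y"
      by (simp add: dirichlet_weight_def prod_dividef[symmetric] prod_powr_distrib prod.distrib[symmetric]
          powr_diff[symmetric] powr_powr powr_add[symmetric] algebra_simps)
    have "dirichlet_density d u y * ratio y powr s =
        dirichlet_weight d u y * (dirichlet_weight d u y / dirichlet_weight d v y) powr s * C"
      using B by (simp add: ratio_def dirichlet_density_def C_def powr_mult powr_divide powr_add mult_ac)
    then show ?thesis
      by (simp only: weight mult.commute)
  qed
  have "(\<integral>\<^sup>+y. ennreal (ratio y powr s) \<partial>P) =
      (\<integral>\<^sup>+y. ennreal (dirichlet_density d u y) * ennreal (ratio y powr s) \<partial>simplex_measure d)"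
    unfolding P_eq by (subst nn_integral_density) auto
  also have "\<dots> = (\<integral>\<^sup>+y. ennreal C * ennreal (dirichlet_weight d ?w y) \<partial>simplex_measure d)"
    using C by (intro nn_integral_cong) (simp add: ennreal_mult'[symmetric] eq dirichlet_density_nonneg)
  also have "\<dots> = ennreal C * ennreal (?B ?w)"
    using d assms by (subst nn_integral_cmult) (simp_all add: nn_integral_dirichlet_weight)
  also have "\<dots> = ennreal (C * ?B ?w)"
    using C by (simp add: ennreal_mult')
  also have "C * ?B ?w = exp (log_moment s)"
    using B by (simp add: C_def log_moment_def powr_def exp_add exp_diff mult_ac)
  finally show ?thesis .
qed

lemma renyi_divergence_eq:
  assumes "1 < l" "\<And>i. i < d \<Longrightarrow> 0 < u i + (l - 1) * (u i - v i)"
  shows "renyi_divergence l P Q = ereal (log_moment (l - 1) / (l - 1))"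
proof -
  have "(\<integral>\<^sup>+y. ennreal (enn2real (RN_deriv Q P y) powr (l - 1)) \<partial>P) =
      (\<integral>\<^sup>+y. ennreal (ratio y powr (l - 1)) \<partial>P)"
    using AE_RN_deriv by (intro nn_integral_cong_AE) auto
  also have "\<dots> = ennreal (exp (log_moment (l - 1)))"
    using assms(2) by (rule nn_integral_ratio_powr)
  finally show ?thesis
    using assms(1) absolutely_continuous by (simp add: renyi_divergence_def)
qed

section \<open>Order one: the Kullback-Leibler divergence\<close>

lemma integrable_ratio_powr:
  assumes "\<And>i. i < d \<Longrightarrow> 0 < u i + s * (u i - v i)"
  shows "integrable P (\<lambda>y. ratio y powr s)" "(\<integral>y. ratio y powr s \<partial>P) = exp (log_moment s)"
  using nn_integral_ratio_powr[OF assms]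
  by (auto intro!: integrableI_nonneg simp: integral_eq_nn_integral)

text \<open>This excludes the infinite branch of \<open>renyi_divergence 1\<close>. A small positive
  power of \<open>ratio\<close> controls the logarithm from above, and the power \<open>- 1\<close>
  controls it from below.\<close>

lemma integrable_ln_ratio:
  assumes "0 < s" "\<And>i. i < d \<Longrightarrow> 0 < u i + s * (u i - v i)"
  shows "integrable P (\<lambda>y. ln (ratio y))"
proof (rule Bochner_Integration.integrable_bound)
  show "integrable P (\<lambda>y. ratio y powr s / s + ratio y powr (- 1))"
    \<comment> \<open>For the order \<open>- 1\<close> the tilted parameter is
      \<open>u i - (u i - v i) = v i\<close>, hence positive.\<close>
    using assms(2) v_pos
    by (intro Bochner_Integration.integrable_add integrable_divide_zero integrable_ratio_powr) auto
  show "AE y in P. norm (ln (ratio y)) \<le> norm (ratio y powr s / s + ratio y powr (- 1))"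
    using AE_ratio_pos
  proof eventually_elim
    case (elim y)
    have "ln (ratio y powr s) \<le> ratio y powr s - 1"
      using elim by (intro ln_le_minus_one) simp
    then have "ln (ratio y) \<le> ratio y powr s / s"
      using elim assms(1) by (simp add: ln_powr field_simps)
    moreover have "ln (ratio y powr (- 1)) \<le> ratio y powr (- 1) - 1"
      using elim by (intro ln_le_minus_one) simp
    then have "- ln (ratio y) \<le> ratio y powr (- 1)"
      using elim by (simp add: ln_powr ln_div)
    moreover have "0 \<le> ratio y powr s / s" "0 \<le> ratio y powr (- 1)"
      using assms(1) by auto
    ultimately show ?case
      unfolding real_norm_def by linarith
  qed
qed measurable

text \<open>Jensen's inequality for the logarithm, proved through its tangent:
  \<open>ln x \<le> x - 1\<close> is applied to \<open>ratio y powr s\<close> divided by its mean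
  \<open>?E\<close>, so that the right-hand side integrates to \<open>log_moment s\<close>.\<close>

lemma integral_ln_ratio_le:
  assumes "0 < s" "\<And>i. i < d \<Longrightarrow> 0 < u i + s * (u i - v i)"
  shows "(\<integral>y. ln (ratio y) \<partial>P) \<le> log_moment s / s"
proof -
  let ?E = "exp (log_moment s)"
  note int = integrable_ratio_powr[OF assms(2)]
  have "(\<integral>y. s * ln (ratio y) \<partial>P) \<le> (\<integral>y. ratio y powr s / ?E - 1 + log_moment s \<partial>P)"
  proof (rule integral_mono_AE)
    show "AE y in P. s * ln (ratio y) \<le> ratio y powr s / ?E - 1 + log_moment s"
      using AE_ratio_pos
    proof eventually_elim
      case (elim y)
      then have "ln (ratio y powr s / ?E) \<le> ratio y powr s / ?E - 1"
        by (intro ln_le_minus_one) simp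
      then show ?case
        using elim by (simp add: ln_div ln_powr)
    qed
  qed (use integrable_ln_ratio[OF assms] int in auto)
  also have "\<dots> = log_moment s"
    using int by (simp add: P.prob_space)
  finally show ?thesis
    using assms(1) by (simp add: field_simps)
qed

lemma renyi_divergence_1_le:
  assumes "0 < s" "\<And>i. i < d \<Longrightarrow> 0 < u i + s * (u i - v i)"
  shows "renyi_divergence 1 P Q \<le> ereal (log_moment s / s)"
proof -
  have meas: "entropy_density (exp 1) Q P \<in> borel_measurable P" "(\<lambda>y. ln (ratio y)) \<in> borel_measurable P"
    using measurable_entropy_density[of "exp 1" Q P] by (simp_all add: measurable_cong_sets[OF sets_P] measurable_cong_sets[OF sets_Q])
  have AE: "AE y in P. entropy_density (exp 1) Q P y = ln (ratio y)"
    using AE_RN_deriv by eventually_elim (simp add: entropy_density_def log_def)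
  have "integrable P (entropy_density (exp 1) Q P)"
    using integrable_cong_AE[OF meas AE] integrable_ln_ratio[OF assms] by simp
  moreover have "KL_divergence (exp 1) Q P = (\<integral>y. ln (ratio y) \<partial>P)"
    unfolding KL_divergence_def by (rule integral_cong_AE[OF meas AE])
  ultimately show ?thesis
    using absolutely_continuous integral_ln_ratio_le[OF assms] by (simp add: renyi_divergence_def)
qed

section \<open>Divergence bounds in terms of the trigamma function\<close>

lemma log_moment_le:
  assumes "0 < m" "0 < s"
    and "\<And>i. i < d \<Longrightarrow> m \<le> u i" "\<And>i. i < d \<Longrightarrow> m \<le> v i" "\<And>i. i < d \<Longrightarrow> m \<le> u i + s * (u i - v i)"
  shows "log_moment s / s \<le> (1 + s) / 2 * Polygamma 1 m * (\<Sum>i<d. (u i - v i)\<^sup>2)"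
  using ln_multi_Beta_extrapolate_le[OF d assms] assms(2)
  by (simp add: log_moment_def field_simps)

lemma renyi_divergence_le:
  assumes "1 < l" "0 < m"
    and "\<And>i. i < d \<Longrightarrow> m \<le> u i" "\<And>i. i < d \<Longrightarrow> m \<le> v i" "\<And>i. i < d \<Longrightarrow> m \<le> u i + (l - 1) * (u i - v i)"
  shows "renyi_divergence l P Q \<le> ereal (l / 2 * Polygamma 1 m * (\<Sum>i<d. (u i - v i)\<^sup>2))"
  using log_moment_le[of m "l - 1"] assms
  by (subst renyi_divergence_eq) (auto intro: less_le_trans)

text \<open>The extrapolated parameters may fall below \<open>m\<close>, but by at most
  \<open>s * R\<close>. The bound therefore holds with \<open>m - s * R\<close> for every small
  \<open>s > 0\<close>, and continuity of the trigamma function allows \<open>s\<close> to tend to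
  zero.\<close>

lemma renyi_divergence_1_le_Polygamma:
  assumes "0 < m" "\<And>i. i < d \<Longrightarrow> m \<le> u i" "\<And>i. i < d \<Longrightarrow> m \<le> v i"
    and R: "\<And>i. i < d \<Longrightarrow> \<bar>u i - v i\<bar> \<le> R" "0 < R"
  shows "renyi_divergence 1 P Q \<le> ereal (1 / 2 * Polygamma 1 m * (\<Sum>i<d. (u i - v i)\<^sup>2))"
proof (rule tendsto_lowerbound)
  let ?W = "\<Sum>i<d. (u i - v i)\<^sup>2"
  have "((\<lambda>s. (1 + s) / 2 * Polygamma 1 (m - s * R) * ?W) \<longlongrightarrow> (1 + 0) / 2 * Polygamma 1 (m - 0 * R) * ?W) (at_right 0)"
    using assms(1) by (intro tendsto_intros) (auto elim!: nonpos_Ints_cases)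
  then show "((\<lambda>s. ereal ((1 + s) / 2 * Polygamma 1 (m - s * R) * ?W)) \<longlongrightarrow> ereal (1 / 2 * Polygamma 1 m * ?W)) (at_right 0)"
    by simp
  \<comment> \<open>The condition \<open>s < m / R\<close> keeps \<open>m - s * R\<close>
    positive.\<close>
  have "eventually (\<lambda>s. s \<in> {0<..<m / R}) (at_right 0)"
    using assms(1) R(2) by (intro eventually_at_right_real) simp
  then show "eventually (\<lambda>s. renyi_divergence 1 P Q \<le> ereal ((1 + s) / 2 * Polygamma 1 (m - s * R) * ?W)) (at_right 0)"
  proof eventually_elim
    case (elim s)
    then have s: "0 < s" "0 < m - s * R" "0 \<le> s * R"
      using R(2) by (auto simp: field_simps)
    have "m - s * R \<le> u i + s * (u i - v i)" if "i < d" for i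
    proof -
      have "s * (- R) \<le> s * (u i - v i)"
        using s(1) R(1)[OF that] by (intro mult_left_mono) auto
      then show ?thesis
        using assms(2)[OF that] by simp
    qed
    moreover have "m - s * R \<le> u i" "m - s * R \<le> v i" if "i < d" for i
      using assms(2,3)[OF that] s(3) by linarith+
    ultimately have "renyi_divergence 1 P Q \<le> ereal (log_moment s / s)"
      and "log_moment s / s \<le> (1 + s) / 2 * Polygamma 1 (m - s * R) * ?W"
      using s by (blast intro: renyi_divergence_1_le log_moment_le less_le_trans[OF s(2)])+
    then show ?case
      by (meson ereal_less_eq(3) order_trans)
  qed
qed simp

end

section \<open>Privacy of the Dirichlet mechanism\<close>

theorem theorem1:
  fixes d N :: nat and X :: "'x set"
    and f :: "(nat \<Rightarrow> 'x) \<Rightarrow> (nat \<Rightarrow> real)"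
    and \<Delta>2 \<Delta>inf l \<epsilon> r \<alpha> :: real
  assumes "d \<ge> 2" and "N \<ge> 1"
    and "f \<in> ({..<N} \<rightarrow>\<^sub>E X) \<rightarrow> ({..<d} \<rightarrow>\<^sub>E {0..})"
    and "\<Delta>2 > 0" and "\<Delta>inf > 0"
    and "\<And>x x'. neighboring N X x x' \<Longrightarrow> (L2_set (\<lambda>i. f x i - f x' i) {..<d})\<^sup>2 \<le> \<Delta>2\<^sup>2"
    and "\<And>x x'. neighboring N X x x' \<Longrightarrow> Max ((\<lambda>i. \<bar>f x i - f x' i\<bar>) ` {..<d}) \<le> \<Delta>inf"
    and "l \<ge> 1" and "\<epsilon> > 0" and "r > 0"
    and "\<epsilon> = 1/2 * l * r\<^sup>2 * \<Delta>2\<^sup>2 * Polygamma 1 (1 + 3 * (l - 1) * r * \<Delta>inf)"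
    and "\<alpha> = 1 + 4 * (l - 1) * r * \<Delta>inf"
  shows "renyi_dp (neighboring N X) l \<epsilon> (\<lambda>x. dirichlet d (\<lambda>i. r * f x i + \<alpha>))"
  unfolding renyi_dp_def
proof (intro allI impI)
  fix x x' assume nbr: "neighboring N X x x'"
  define u where "u i = r * f x i + \<alpha>" for i
  define v where "v i = r * f x' i + \<alpha>" for i
  define R where "R = r * \<Delta>inf"
  define m where "m = 1 + 3 * (l - 1) * R"
  have R: "0 < R"
    using assms by (simp add: R_def)
  then have lR: "0 \<le> (l - 1) * R"
    using \<open>l \<ge> 1\<close> by simp
  \<comment> \<open>The slack \<open>\<alpha> - m = (l - 1) * R\<close> is the largest amount by
    which \<open>(l - 1) * (u i - v i)\<close> can lower a coordinate; this gives
    \<open>ge_w\<close> below.\<close>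
  have m: "0 < m" and \<alpha>: "\<alpha> = m + (l - 1) * R" and psi: "0 < Polygamma 1 m"
    using lR by (auto simp: m_def R_def assms(12) algebra_simps intro!: Polygamma_real_odd_pos elim!: nonpos_Ints_cases)
  have fnn: "0 \<le> f x i" "0 \<le> f x' i" if "i < d" for i
    using nbr assms(3) that by (auto simp: neighboring_def Pi_iff PiE_iff)
  then have ge: "\<alpha> \<le> u i" "\<alpha> \<le> v i" if "i < d" for i
    using that assms(10) by (auto simp: u_def v_def)
  then have ge_m: "m \<le> u i" "m \<le> v i" if "i < d" for i
    using that lR \<alpha> by (meson add_increasing2 order_refl order_trans)+
  have diff: "u i - v i = r * (f x i - f x' i)" for i
    by (simp add: u_def v_def algebra_simps)
  have le_R: "\<bar>u i - v i\<bar> \<le> R" if "i < d" for i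
  proof -
    have "\<bar>f x i - f x' i\<bar> \<le> \<Delta>inf"
      using assms(7)[OF nbr] that by (subst (asm) Max_le_iff) auto
    then show ?thesis
      using assms(10) by (simp add: diff R_def abs_mult)
  qed
  have ge_w: "m \<le> u i + (l - 1) * (u i - v i)" if "i < d" for i
  proof -
    have "(l - 1) * (- R) \<le> (l - 1) * (u i - v i)"
      using le_R[OF that] assms(8) by (intro mult_left_mono) auto
    then show ?thesis
      using ge(1)[OF that] \<alpha> by simp
  qed
  interpret dirichlet_pair d u v
    using assms(1) ge_m m by unfold_locales (auto intro: less_le_trans)
  have "renyi_divergence l P Q \<le> ereal (l / 2 * Polygamma 1 m * (\<Sum>i<d. (u i - v i)\<^sup>2))"
  \<comment> \<open>The closed form \<open>log_moment (l - 1) / (l - 1)\<close> is available only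
    for \<open>l > 1\<close>; order one uses the limit argument.\<close>
  proof (cases "l = 1")
    case True
    show ?thesis
      using renyi_divergence_1_le_Polygamma[OF m ge_m le_R R] True by simp
  next
    case False
    then show ?thesis
      using renyi_divergence_le[OF _ m ge_m ge_w] assms(8) by simp
  qed
  also have "(\<Sum>i<d. (u i - v i)\<^sup>2) = r\<^sup>2 * (L2_set (\<lambda>i. f x i - f x' i) {..<d})\<^sup>2"
    by (simp add: diff L2_set_def sum_nonneg power_mult_distrib sum_distrib_left)
  also have "l / 2 * Polygamma 1 m * (r\<^sup>2 * (L2_set (\<lambda>i. f x i - f x' i) {..<d})\<^sup>2)
      \<le> l / 2 * Polygamma 1 m * (r\<^sup>2 * \<Delta>2\<^sup>2)"
    using assms(6)[OF nbr] assms(8) psi by (intro mult_left_mono) auto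
  also have "\<dots> = \<epsilon>"
    by (simp add: assms(11) m_def R_def mult_ac)
  finally show "renyi_divergence l (dirichlet d (\<lambda>i. r * f x i + \<alpha>)) (dirichlet d (\<lambda>i. r * f x' i + \<alpha>)) \<le> ereal \<epsilon>"
    by (simp add: u_def[abs_def] v_def[abs_def])
qed

end
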